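(* Let $L$ be a lattice with $(q-1)L_\beta\subseteq L\subseteq L_\beta$, and let $d_1,\dots,d_n$ be the invariant factors of $L_\beta/L$. Then the number of $\mathbb F_q$-rational points is $|V_{X(\mathbb F_q)}(I_L)|=|L_\beta/L|=d_1\cdots d_n$.
   Context: $\mathbb K=\mathbb F_q$ is a finite field with algebraic closure $\overline{\mathbb K}$. $\Sigma$ is a complete simplicial fan in $\mathbb R^n$ with rays $\rho_1,\dots,\rho_r$ generated by primitive lattice vectors $\mathbf v_1,\dots,\mathbf v_r\in\mathbb Z^n$, and $X=X_\Sigma$ is the corresponding split toric variety over $\mathbb K$; its class group $\operatorname{Cl}X$ is assumed to be free. Let $\phi:\mathbb Z^n\to\mathbb Z^r$ be the $r\times n$ matrix with rows $\mathbf v_1,\dots,\mathbf v_r$, let $d=r-n$, and let $\beta:\mathbb Z^r\to\mathbb Z^d\cong \operatorname{Cl}X$ be an integer matrix such that $0\to\mathbb Z^n\xrightarrow{\phi}\mathbb Z^r\xrightarrow{\beta}\mathbb Z^d\to0$ is exact. $L_\beta=\operatorname{im}\phi=\ker\beta\subseteq\mathbb Z^r$, a lattice of rank $n$. The Cox ring $S=\mathbb K[x_1,\dots,x_r]$ is graded by $\deg x_j=\beta_j$, the $j$-th column of $\beta$; "homogeneous" refers to this grading. For a sublattice $L\subseteq L_\beta$, the lattice ideal is $I_L=\langle \mathbf x^{\mathbf m^+}-\mathbf x^{\mathbf m^-} : \mathbf m=\mathbf m^+-\mathbf m^-\in L\rangle\subseteq S$, where $\mathbf m^{\pm}\in\mathbb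 N^r$ are the positive and negative parts of $\mathbf m$. $B\subseteq S$ is the monomial ideal generated by $\prod_{\rho_i\not\subseteq\sigma}x_i$, $\sigma\in\Sigma$. $G=\{P\in(\overline{\mathbb K}^* )^r : \mathbf x^{\mathbf m}(P)=1 \text{ for all } \mathbf m\in L_\beta\}$, where $\mathbf x^{\mathbf a}(P)=p_1^{a_1}\cdots p_r^{a_r}$. $X(\mathbb K)$ is the set of orbits $[P]=G\cdot P$ with $P\in\mathbb K^r\setminus V(B)$. For a homogeneous ideal $J$, $V_{X(\mathbb K)}(J)=\{[P]\in X(\mathbb K): F(P)=0\text{ for all homogeneous }F\in J\}$. Invariant factors of $L_\beta/L$: the positive integers $d_1\mid d_2\mid\cdots\mid d_n$ (the value $1$ allowed) such that $L_\beta$ has a basis $\mathbf m_1,\dots,\mathbf m_n$ with $d_1\mathbf m_1,\dots,d_n\mathbf m_n$ a basis of $L$. *)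

theory Defs
  imports
    "HOL-Analysis.Analysis"
    "HOL-Library.Poly_Mapping"
    "HOL-Algebra.Algebraic_Closure_Type"
begin

section \<open>Lattices\<close>

text \<open>Subgroups of \<open>\<int>\<^sup>r\<close> are treated as \<open>\<int>\<close>-submodules, and ideals of a commutative ring as
  submodules of the ring over itself.\<close>

global_interpretation zmod: Modules.module "(*s) :: int \<Rightarrow> int ^ 'r \<Rightarrow> int ^ 'r"
  by unfold_locales (simp_all add: vec_eq_iff algebra_simps)

global_interpretation ideal: Modules.module "(*) :: 'a::comm_ring_1 \<Rightarrow> 'a \<Rightarrow> 'a"
  by unfold_locales (simp_all add: algebra_simps)

definition lattice_basis :: "nat \<Rightarrow> (nat \<Rightarrow> int ^ 'r) \<Rightarrow> (int ^ 'r) set \<Rightarrow> bool" where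
  "lattice_basis n b L \<longleftrightarrow>
     inj_on b {1..n} \<and> zmod.independent (b ` {1..n}) \<and> zmod.span (b ` {1..n}) = L"

definition invariant_factors ::
    "nat \<Rightarrow> (int ^ 'r) set \<Rightarrow> (int ^ 'r) set \<Rightarrow> (nat \<Rightarrow> nat) \<Rightarrow> bool" where
  "invariant_factors n M L d \<longleftrightarrow>
     (\<forall>i\<in>{1..n}. d i > 0) \<and> (\<forall>i. 1 \<le> i \<and> i < n \<longrightarrow> d i dvd d (Suc i)) \<and>
     (\<exists>b. lattice_basis n b M \<and> lattice_basis n (\<lambda>i. int (d i) *s b i) L)"

definition lattice_quotient :: "(int ^ 'r) set \<Rightarrow> (int ^ 'r) set \<Rightarrow> (int ^ 'r) set set" where
  "lattice_quotient M L = M // {(x, y). x \<in> M \<and> y \<in> M \<and> x - y \<in> L}"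

definition kernel_lattice :: "int ^ 'r ^ 'd \<Rightarrow> (int ^ 'r) set" where
  "kernel_lattice \<beta> = {m. \<beta> *v m = 0}"

text \<open>Exactness of \<open>0 \<rightarrow> \<int>\<^sup>n \<rightarrow> \<int>\<^sup>r \<rightarrow> \<int>\<^sup>d \<rightarrow> 0\<close>. It forces \<open>d = r - n\<close>, and it expresses that the class
  group, the cokernel of \<open>\<phi>\<close>, is free.\<close>

definition short_exact :: "int ^ 'n ^ 'r \<Rightarrow> int ^ 'r ^ 'd \<Rightarrow> bool" where
  "short_exact \<phi> \<beta> \<longleftrightarrow>
     inj (\<lambda>u. \<phi> *v u) \<and> (\<lambda>u. \<phi> *v u) ` UNIV = kernel_lattice \<beta> \<and> surj (\<lambda>m. \<beta> *v m)"


section \<open>Fans\<close>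

definition real_vec :: "int ^ 'n \<Rightarrow> real ^ 'n" where
  "real_vec u = (\<chi> j. of_int (u $ j))"

definition primitive :: "int ^ 'n \<Rightarrow> bool" where
  "primitive u \<longleftrightarrow> Gcd ((\<lambda>j. u $ j) ` UNIV) = 1"

definition rational_polyhedral_cone :: "(real ^ 'n) set \<Rightarrow> bool" where
  "rational_polyhedral_cone \<sigma> \<longleftrightarrow> (\<exists>A. finite A \<and> \<sigma> = convex_cone hull (real_vec ` A))"

definition strongly_convex :: "(real ^ 'n) set \<Rightarrow> bool" where
  "strongly_convex \<sigma> \<longleftrightarrow> \<sigma> \<inter> uminus ` \<sigma> = {0}"

definition simplicial_cone :: "(real ^ 'n) set \<Rightarrow> bool" where
  "simplicial_cone \<sigma> \<longleftrightarrow> (\<exists>A. independent A \<and> \<sigma> = convex_cone hull A)"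

text \<open>The library counts the empty set among the faces of a convex set; it is not a face of a
  cone in the sense of toric geometry.\<close>

definition fan :: "(real ^ 'n) set set \<Rightarrow> bool" where
  "fan \<Sigma> \<longleftrightarrow> finite \<Sigma> \<and>
     (\<forall>\<sigma>\<in>\<Sigma>. rational_polyhedral_cone \<sigma> \<and> strongly_convex \<sigma>) \<and>
     (\<forall>\<sigma>\<in>\<Sigma>. \<forall>\<tau>. \<tau> face_of \<sigma> \<and> \<tau> \<noteq> {} \<longrightarrow> \<tau> \<in> \<Sigma>) \<and>
     (\<forall>\<sigma>\<in>\<Sigma>. \<forall>\<tau>\<in>\<Sigma>. (\<sigma> \<inter> \<tau>) face_of \<sigma> \<and> (\<sigma> \<inter> \<tau>) face_of \<tau>)"

definition simplicial_fan :: "(real ^ 'n) set set \<Rightarrow> bool" where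
  "simplicial_fan \<Sigma> \<longleftrightarrow> fan \<Sigma> \<and> (\<forall>\<sigma>\<in>\<Sigma>. simplicial_cone \<sigma>)"

definition complete_fan :: "(real ^ 'n) set set \<Rightarrow> bool" where
  "complete_fan \<Sigma> \<longleftrightarrow> fan \<Sigma> \<and> \<Union>\<Sigma> = UNIV"

definition ray :: "int ^ 'n \<Rightarrow> (real ^ 'n) set" where
  "ray u = convex_cone hull {real_vec u}"

text \<open>The rows of \<open>\<phi>\<close> are the primitive generators of the rays of \<open>\<Sigma>\<close>, without repetition.\<close>

definition ray_generators :: "(real ^ 'n) set set \<Rightarrow> int ^ 'n ^ 'r \<Rightarrow> bool" where
  "ray_generators \<Sigma> \<phi> \<longleftrightarrow> (\<forall>i. primitive (\<phi> $ i)) \<and>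
     bij_betw (\<lambda>i. ray (\<phi> $ i)) UNIV {\<rho> \<in> \<Sigma>. aff_dim \<rho> = 1}"


section \<open>The Cox ring\<close>

type_synonym ('k, 'r) cox_ring = "('r \<Rightarrow>\<^sub>0 nat) \<Rightarrow>\<^sub>0 'k"

definition monomial :: "('r \<Rightarrow>\<^sub>0 nat) \<Rightarrow> ('k::field, 'r) cox_ring" where
  "monomial a = Poly_Mapping.single a 1"

definition variable :: "'r \<Rightarrow> ('k::field, 'r) cox_ring" where
  "variable i = monomial (Poly_Mapping.single i 1)"

text \<open>\<open>\<beta> *v a\<close> is the sum of the \<open>\<beta>\<^sub>j\<close> with multiplicities \<open>a\<^sub>j\<close>, where \<open>\<beta>\<^sub>j\<close> is the \<open>j\<close>-th column.\<close>

definition multidegree :: "int ^ 'r ^ 'd \<Rightarrow> ('r \<Rightarrow>\<^sub>0 nat) \<Rightarrow> int ^ 'd" where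
  "multidegree \<beta> a = \<beta> *v (\<chi> j. int (Poly_Mapping.lookup a j))"

definition homogeneous :: "int ^ 'r ^ 'd \<Rightarrow> ('k::field, 'r) cox_ring \<Rightarrow> bool" where
  "homogeneous \<beta> F \<longleftrightarrow> (\<exists>\<alpha>. \<forall>a\<in>Poly_Mapping.keys F. multidegree \<beta> a = \<alpha>)"

definition eval_at :: "('k::field, 'r::finite) cox_ring \<Rightarrow> 'k alg_closure ^ 'r \<Rightarrow> 'k alg_closure" where
  "eval_at F P = (\<Sum>a\<in>Poly_Mapping.keys F. to_ac (Poly_Mapping.lookup F a) *
      (\<Prod>i\<in>UNIV. (P $ i) ^ Poly_Mapping.lookup a i))"

text \<open>The positive part of \<open>m\<close>; its negative part is \<open>pos_part (- m)\<close>.\<close>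

lift_definition pos_part :: "int ^ 'r \<Rightarrow> 'r::finite \<Rightarrow>\<^sub>0 nat" is "\<lambda>(m :: int ^ 'r) i. nat (m $ i)"
  by simp

definition lattice_ideal :: "(int ^ 'r) set \<Rightarrow> ('k::field, 'r::finite) cox_ring set" where
  "lattice_ideal L = ideal.span {monomial (pos_part m) - monomial (pos_part (- m)) | m. m \<in> L}"

definition irrelevant_ideal ::
    "(real ^ 'n) set set \<Rightarrow> int ^ 'n ^ 'r \<Rightarrow> ('k::field, 'r::finite) cox_ring set" where
  "irrelevant_ideal \<Sigma> \<phi> =
     ideal.span {\<Prod>i\<in>{i. \<not> ray (\<phi> $ i) \<subseteq> \<sigma>}. variable i | \<sigma>. \<sigma> \<in> \<Sigma>}"

definition zero_locus :: "('k::field, 'r::finite) cox_ring set \<Rightarrow> ('k alg_closure ^ 'r) set" where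
  "zero_locus J = {P. \<forall>F\<in>J. eval_at F P = 0}"


section \<open>Rational points\<close>

definition cox_group :: "int ^ 'r ^ 'd \<Rightarrow> ('k::field alg_closure ^ 'r) set" where
  "cox_group \<beta> = {g. (\<forall>i. g $ i \<noteq> 0) \<and>
     (\<forall>m\<in>kernel_lattice \<beta>. (\<Prod>i\<in>UNIV. (g $ i) powi (m $ i)) = 1)}"

definition cox_orbit ::
    "int ^ 'r ^ 'd \<Rightarrow> 'k::field alg_closure ^ 'r \<Rightarrow> ('k alg_closure ^ 'r) set" where
  "cox_orbit \<beta> P = {(\<chi> i. g $ i * P $ i) | g. g \<in> cox_group \<beta>}"

definition rational_vectors :: "('k::field alg_closure ^ 'r) set" where
  "rational_vectors = {P. \<forall>i. \<exists>c. P $ i = to_ac c}"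

definition toric_points ::
    "(real ^ 'n) set set \<Rightarrow> int ^ 'n ^ 'r \<Rightarrow> int ^ 'r ^ 'd \<Rightarrow>
      ('k::field alg_closure ^ 'r::finite) set set" where
  "toric_points \<Sigma> \<phi> \<beta> =
     {cox_orbit \<beta> P | P. P \<in> rational_vectors - zero_locus (irrelevant_ideal \<Sigma> \<phi>)}"

text \<open>Vanishing of a homogeneous polynomial does not depend on the representative of an orbit.\<close>

definition toric_zero_locus ::
    "(real ^ 'n) set set \<Rightarrow> int ^ 'n ^ 'r \<Rightarrow> int ^ 'r ^ 'd \<Rightarrow> ('k::field, 'r::finite) cox_ring set \<Rightarrow>
      ('k alg_closure ^ 'r) set set" where
  "toric_zero_locus \<Sigma> \<phi> \<beta> J =
     {p \<in> toric_points \<Sigma> \<phi> \<beta>. \<forall>P\<in>p. \<forall>F\<in>J. homogeneous \<beta> F \<longrightarrow> eval_at F P = 0}"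

end

theory Submission
  imports Defs
begin

text \<open>Write \<open>M = ker \<beta>\<close> and \<open>q\<close> for the number of elements of the field. The lattice ideal is generated
  by binomials, and on the torus the binomial of \<open>m\<close> vanishes iff the character \<open>x\<^sup>m\<close> takes the value 1.

  A point of the zero locus cannot have a vanishing coordinate
  (\<open>lattice_ideal_vanishing_imp_torus\<close>). The rays belonging to its vanishing coordinates lie in one
  strongly convex cone, hence on the positive side of some integral hyperplane. This provides an
  \<open>m \<in> (q - 1) M \<subseteq> L\<close> that is positive on all those coordinates, and exactly one of the two monomials
  of its binomial vanishes at the point.

  Hence the zero locus consists of orbits in the torus. These orbits correspond to homomorphisms from
  \<open>M\<close> to the multiplicative group of the field: characters from \<open>M\<close> separate the orbits, and
  every homomorphism is realised because \<open>M\<close> is a direct summand of \<open>\<int>\<^sup>r\<close> (\<open>dual_basis_exists\<close>). The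
  conditions imposed by \<open>L\<close> leave the homomorphisms that are trivial on \<open>L\<close>. Choose a basis \<open>b k\<close> of
  \<open>M\<close> such that the \<open>d k *s b k\<close> form a basis of \<open>L\<close>. Then such a homomorphism is a tuple of field
  elements \<open>t k\<close> with \<open>t k ^ d k = 1\<close>. Because \<open>(q - 1) M \<subseteq> L\<close>, each \<open>d k\<close> divides \<open>q - 1\<close>, so a field
  with \<open>q\<close> elements contains exactly \<open>d k\<close> such roots of unity (\<open>card_roots_of_unity\<close>). The number of
  points is thus the product of the \<open>d k\<close>, which is also the index of \<open>L\<close> in \<open>M\<close>.\<close>

(* Power series use the same symbol for coefficients as vectors do for components. *)
no_notation fps_nth (infixl "$" 75)

(* For a ring as a module over itself this rule reads x * (y * z) = x * y * z and makes rewriting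
   with mult.assoc loop. *)
declare ideal.scale_scale [simp del]


section \<open>Polynomials as functions\<close>

lemma eval_at_superset:
  assumes "finite A" "Poly_Mapping.keys F \<subseteq> A"
  shows "eval_at F P = (\<Sum>a\<in>A. to_ac (Poly_Mapping.lookup F a) *
      (\<Prod>i\<in>UNIV. (P $ i) ^ Poly_Mapping.lookup a i))"
  unfolding eval_at_def
  by (rule sum.mono_neutral_left) (use assms in \<open>auto simp: in_keys_iff\<close>)

lemma eval_at_add: "eval_at (F + G) P = eval_at F P + eval_at G P"
proof -
  let ?A = "Poly_Mapping.keys F \<union> Poly_Mapping.keys G"
  have "Poly_Mapping.keys (F + G) \<subseteq> ?A"
    by (rule keys_add)
  then show ?thesis
    by (simp add: eval_at_superset[of ?A] lookup_add sum.distrib[symmetric] distrib_right)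
qed

lemma eval_at_0: "eval_at 0 P = 0"
  by (simp add: eval_at_def)

lemma eval_at_diff: "eval_at (F - G) P = eval_at F P - eval_at G P"
  using eval_at_add[of "F - G" G P] by simp

lemma eval_at_sum: "eval_at (\<Sum>x\<in>A. f x) P = (\<Sum>x\<in>A. eval_at (f x) P)"
  by (induction A rule: infinite_finite_induct) (auto simp: eval_at_0 eval_at_add)

lemma eval_at_single:
  "eval_at (Poly_Mapping.single a c) P = to_ac c * (\<Prod>i\<in>UNIV. (P $ i) ^ Poly_Mapping.lookup a i)"
  by (subst eval_at_superset[of "{a}"]) auto

lemma sum_single_terms:
  "(\<Sum>a\<in>Poly_Mapping.keys F. Poly_Mapping.single a (Poly_Mapping.lookup F a)) = F"
  by (rule poly_mapping_eqI) (auto simp: lookup_sum lookup_single when_def in_keys_iff)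

text \<open>Both sides are bilinear, so it suffices to compare them on single terms.\<close>

lemma eval_at_mult: "eval_at (F * G) P = eval_at F P * eval_at G P"
proof -
  let ?s = "\<lambda>F a. Poly_Mapping.single a (Poly_Mapping.lookup F a)"
  have single: "eval_at (?s F a * ?s G b) P = eval_at (?s F a) P * eval_at (?s G b) P" for a b
    by (simp add: mult_single eval_at_single lookup_add power_add prod.distrib)
  have "eval_at (F * G) P
      = eval_at ((\<Sum>a\<in>Poly_Mapping.keys F. ?s F a) * (\<Sum>b\<in>Poly_Mapping.keys G. ?s G b)) P"
    by (simp only: sum_single_terms)
  also have "\<dots> = eval_at (\<Sum>a\<in>Poly_Mapping.keys F. ?s F a) P
      * eval_at (\<Sum>b\<in>Poly_Mapping.keys G. ?s G b) P"
    by (simp only: sum_product eval_at_sum single)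
  finally show ?thesis
    by (simp only: sum_single_terms)
qed

lemma eval_at_monomial:
  "eval_at (monomial a) P = (\<Prod>i\<in>UNIV. (P $ i) ^ Poly_Mapping.lookup a i)"
  by (simp add: monomial_def eval_at_single)

lemma eval_at_variable: "eval_at (variable i) P = P $ i"
proof -
  have "(\<Prod>j\<in>UNIV. (P $ j) ^ (1 when i = j)) = (\<Prod>j\<in>UNIV. if i = j then P $ j else 1)"
    by (rule prod.cong) (auto simp: when_def)
  then show ?thesis
    by (simp add: variable_def eval_at_monomial lookup_single)
qed

lemma eval_at_prod_variables: "eval_at (\<Prod>i\<in>A. variable i) P = (\<Prod>i\<in>A. P $ i)"
proof -
  have one: "eval_at 1 P = 1"
    by (simp add: eval_at_single flip: single_one)
  have "finite A"
    by simp
  then show ?thesis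
    by induction (simp_all add: one eval_at_mult eval_at_variable)
qed

text \<open>Evaluation at a point is a ring homomorphism, so its kernel is an ideal.\<close>

lemma eval_at_span_eq_0:
  assumes "\<And>F. F \<in> S \<Longrightarrow> eval_at F P = 0" and "F \<in> ideal.span S"
  shows "eval_at F P = 0"
  using assms(2)
proof (induction rule: ideal.span_induct)
  case base
  show ?case
    by (auto simp: ideal.subspace_def eval_at_0 eval_at_add eval_at_mult)
qed (rule assms(1))


section \<open>Laurent monomials on the torus\<close>

text \<open>The character \<open>x\<^sup>m\<close> of the torus. Outside the torus it involves inverses of zero, so the lemmas
  about it assume nonzero coordinates where that matters.\<close>

definition laurent :: "int ^ 'r \<Rightarrow> 'a::field ^ 'r \<Rightarrow> 'a" where
  "laurent m P = (\<Prod>i\<in>UNIV. (P $ i) powi (m $ i))"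

definition torus :: "('a::field ^ 'r) set" where
  "torus = {P. \<forall>i. P $ i \<noteq> 0}"

definition pairing :: "int ^ 'r \<Rightarrow> int ^ 'r \<Rightarrow> int" where
  "pairing m c = (\<Sum>i\<in>UNIV. m $ i * c $ i)"

lemma prod_powi: "(\<Prod>x\<in>A. f x powi a) = (\<Prod>x\<in>A. f x :: 'a::field) powi a"
  by (induction A rule: infinite_finite_induct) (auto simp: power_int_mult_distrib)

lemma powi_sum: "x \<noteq> 0 \<Longrightarrow> (x :: 'a::field) powi (\<Sum>k\<in>A. f k) = (\<Prod>k\<in>A. x powi f k)"
  by (induction A rule: infinite_finite_induct) (auto simp: power_int_add)

lemma to_ac_powi: "to_ac (x powi a) = to_ac x powi a"
  by (cases a rule: int_cases4) (auto simp: power_int_minus)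

lemma laurent_scale: "laurent (a *s m) P = laurent m P powi a"
  by (simp add: laurent_def flip: prod_powi power_int_mult) (simp add: mult.commute)

lemma laurent_sum:
  assumes "P \<in> torus"
  shows "laurent (\<Sum>k\<in>A. f k *s b k) P = (\<Prod>k\<in>A. laurent (b k) P powi f k)"
proof -
  have "laurent (\<Sum>k\<in>A. f k *s b k) P = (\<Prod>i\<in>UNIV. \<Prod>k\<in>A. (P $ i) powi (f k * b k $ i))"
    using assms by (simp add: laurent_def torus_def powi_sum)
  also have "\<dots> = (\<Prod>k\<in>A. laurent (f k *s b k) P)"
    by (subst prod.swap) (simp add: laurent_def)
  finally show ?thesis
    by (simp add: laurent_scale)
qed

lemma laurent_mult: "laurent m (\<chi> i. P $ i * Q $ i) = laurent m P * laurent m Q"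
  by (simp add: laurent_def power_int_mult_distrib prod.distrib)

lemma laurent_divide: "laurent m (\<chi> i. P $ i / Q $ i) = laurent m P / laurent m Q"
  by (simp add: laurent_def power_int_divide_distrib prod_dividef)

lemma laurent_to_ac: "laurent m (\<chi> i. to_ac (p $ i)) = to_ac (laurent m p)"
  by (simp add: laurent_def to_ac_prod to_ac_powi)

lemma laurent_nonzero: "P \<in> torus \<Longrightarrow> laurent m P \<noteq> 0"
  by (simp add: laurent_def torus_def power_int_not_zero)

text \<open>The one-parameter subgroups with exponents \<open>c k\<close>, multiplied together and paired with the
  character \<open>x\<^sup>m\<close>. With a dual family for \<open>c\<close> this produces points with prescribed character values.\<close>

lemma laurent_monomial_vector:
  assumes "\<And>k. k \<in> A \<Longrightarrow> t k \<noteq> (0 :: 'a::field)"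
  shows "laurent m (\<chi> i. \<Prod>k\<in>A. t k powi (c k $ i)) = (\<Prod>k\<in>A. t k powi pairing m (c k))"
proof -
  have "laurent m (\<chi> i. \<Prod>k\<in>A. t k powi (c k $ i))
      = (\<Prod>i\<in>UNIV. \<Prod>k\<in>A. t k powi (m $ i * c k $ i))"
    by (simp add: laurent_def flip: prod_powi power_int_mult) (simp add: mult.commute)
  also have "\<dots> = (\<Prod>k\<in>A. \<Prod>i\<in>UNIV. t k powi (m $ i * c k $ i))"
    by (rule prod.swap)
  also have "\<dots> = (\<Prod>k\<in>A. t k powi pairing m (c k))"
    by (rule prod.cong) (simp_all add: pairing_def powi_sum assms)
  finally show ?thesis .
qed

text \<open>On the torus one may divide by the monomial of the negative part.\<close>

lemma eval_at_binomial_eq_0_iff: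
  fixes P :: "'k::field alg_closure ^ 'r::finite"
  assumes "P \<in> torus"
  shows "eval_at (monomial (pos_part m) - monomial (pos_part (- m)) :: ('k, 'r) cox_ring) P = 0
      \<longleftrightarrow> laurent m P = 1"
proof -
  have pos: "eval_at (monomial (pos_part m) :: ('k, 'r) cox_ring) P 
      = (\<Prod>i\<in>UNIV. (P $ i) powi (int (nat (m $ i))))" for m
    by (simp add: eval_at_monomial pos_part.rep_eq del: int_nat_eq)
  have "(P $ i) powi (m $ i) = (P $ i) powi int (nat (m $ i)) / (P $ i) powi int (nat (- m $ i))" for i
  proof -
    have "int (nat (m $ i)) - int (nat (- m $ i)) = m $ i"
      by simp
    moreover have "(P $ i) powi (int (nat (m $ i)) - int (nat (- m $ i)))
        = (P $ i) powi int (nat (m $ i)) / (P $ i) powi int (nat (- m $ i))"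
      by (rule power_int_diff) (use assms in \<open>simp add: torus_def\<close>)
    ultimately show ?thesis
      by (simp only:)
  qed
  then have "laurent m P = (\<Prod>i\<in>UNIV. (P $ i) powi (int (nat (m $ i))))
      / (\<Prod>i\<in>UNIV. (P $ i) powi (int (nat (- m $ i))))"
    by (simp only: laurent_def prod_dividef)
  moreover have "(\<Prod>i\<in>UNIV. (P $ i) powi (int (nat (- m $ i)))) \<noteq> 0"
    using assms by (simp add: torus_def)
  ultimately show ?thesis
    by (simp add: eval_at_diff pos)
qed


section \<open>Roots of unity in a finite field\<close>

lemma card_field_ge_2: "CARD('k::{field,finite}) \<ge> 2"
proof -
  have "CARD('k) \<ge> card {0, 1 :: 'k}"
    by (rule card_mono) auto
  then show ?thesis
    by simp
qed

text \<open>Multiplication by \<open>t\<close> permutes the nonzero elements, so it preserves their product.\<close>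

lemma finite_field_fermat:
  fixes t :: "'k::{field,finite}"
  assumes "t \<noteq> 0"
  shows "t ^ (CARD('k) - 1) = 1"
proof -
  let ?U = "UNIV - {0 :: 'k}"
  have "bij_betw ((*) t) ?U ?U"
    by (rule bij_betwI[of _ _ _ "\<lambda>x. x / t"]) (use assms in auto)
  then have "(\<Prod>x\<in>?U. t * x) = \<Prod>?U"
    by (rule prod.reindex_bij_betw)
  moreover have "(\<Prod>x\<in>?U. t * x) = t ^ (CARD('k) - 1) * \<Prod>?U"
    by (simp add: prod.distrib card_Diff_singleton)
  moreover have "\<Prod>?U \<noteq> 0"
    by simp
  ultimately show ?thesis
    by simp
qed

text \<open>The polynomial \<open>X ^ d - 1\<close> divides \<open>X ^ (q - 1) - 1\<close>, which has \<open>q - 1\<close> roots. Neither the divisor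
  nor its cofactor can have more roots than its degree, so both have exactly as many.\<close>

lemma card_roots_of_unity:
  assumes "d dvd CARD('k) - 1"
  shows "card {t :: 'k::{field,finite}. t ^ d = 1} = d"
proof -
  let ?q = "CARD('k)"
  obtain e where e: "?q - 1 = d * e"
    using assms by (auto simp: dvd_def)
  have q: "?q \<ge> 2"
    by (rule card_field_ge_2)
  have de: "d > 0" "e > 0"
    using e q by (auto intro!: Nat.gr0I)
  \<comment> \<open>\<open>X ^ (q - 1) - 1 = f * g\<close>, and every nonzero element is a root of the left-hand side.\<close>
  define f :: "'k poly" where "f = Polynomial.monom 1 d - 1"
  define g :: "'k poly" where "g = (\<Sum>j<e. Polynomial.monom 1 (d * j))"
  let ?R = "\<lambda>p. {t :: 'k. poly p t = 0}"
  have f: "poly f t = t ^ d - 1" and g: "poly g t = (\<Sum>j<e. (t ^ d) ^ j)" for t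
    by (simp_all add: f_def g_def poly_monom poly_sum power_mult)
  have "Polynomial.coeff f d = 1"
    using de by (simp add: f_def)
  then have f0: "f \<noteq> 0"
    by auto
  have fd: "Polynomial.degree f \<le> d"
    unfolding f_def by (rule degree_diff_le) (auto simp: degree_monom_le)
  have "Polynomial.coeff g 0 = (\<Sum>j<e. if j = 0 then 1 else 0)"
    using de by (simp add: g_def coeff_sum)
  then have "Polynomial.coeff g 0 = 1"
    using de by simp
  then have g0: "g \<noteq> 0"
    by auto
  have gd: "Polynomial.degree g \<le> d * (e - 1)"
    unfolding g_def
  proof (rule degree_sum_le)
    fix j
    assume "j \<in> {..<e}"
    then have "d * j \<le> d * (e - 1)"
      by (intro mult_le_mono2) auto
    with degree_monom_le show "Polynomial.degree (Polynomial.monom (1 :: 'k) (d * j)) \<le> d * (e - 1)"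
      by (rule order.trans)
  qed simp
  have "UNIV - {0} \<subseteq> ?R f \<union> ?R g"
  proof
    fix t :: 'k
    assume "t \<in> UNIV - {0}"
    then have "t ^ (?q - 1) = 1"
      by (intro finite_field_fermat) simp
    then have "(t ^ d) ^ e - 1 = 0"
      unfolding e power_mult by simp
    moreover have "(t ^ d) ^ e - 1 = poly f t * poly g t"
      unfolding f g by (rule power_diff_1_eq)
    ultimately show "t \<in> ?R f \<union> ?R g"
      by simp
  qed
  then have "card (UNIV - {0 :: 'k}) \<le> card (?R f \<union> ?R g)"
    by (intro card_mono) auto
  then have "?q - 1 \<le> card (?R f) + card (?R g)"
    using card_Un_le[of "?R f" "?R g"] by (simp add: card_Diff_singleton)
  moreover have "card (?R f) \<le> d"
    using card_poly_roots_bound[OF f0] fd by linarith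
  moreover have "card (?R g) \<le> d * (e - 1)"
    using card_poly_roots_bound[OF g0] gd by linarith
  moreover have "d * e = d + d * (e - 1)"
    using de by (cases e) auto
  ultimately have "card (?R f) = d"
    using e by linarith
  then show ?thesis
    by (simp add: f)
qed


section \<open>Bases and dual coordinates\<close>

definition dual_family :: "nat \<Rightarrow> (nat \<Rightarrow> int ^ 'r) \<Rightarrow> (nat \<Rightarrow> int ^ 'r) \<Rightarrow> bool" where
  "dual_family n b c \<longleftrightarrow>
    (\<forall>j\<in>{1..n}. \<forall>k\<in>{1..n}. pairing (b j) (c k) = (if j = k then 1 else 0))"

lemma lattice_basis_coordinates:
  assumes "lattice_basis n b M" "m \<in> M"
  obtains a where "m = (\<Sum>k=1..n. a k *s b k)"
proof -
  have "zmod.span (b ` {1..n}) = range (\<lambda>u. \<Sum>v\<in>b ` {1..n}. u v *s v)"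
    by (rule zmod.span_finite) simp
  then obtain u where "m = (\<Sum>v\<in>b ` {1..n}. u v *s v)"
    using assms by (auto simp: lattice_basis_def)
  also have "\<dots> = (\<Sum>k=1..n. u (b k) *s b k)"
    using assms by (simp add: lattice_basis_def sum.reindex)
  finally show ?thesis
    by (rule that)
qed

lemma lattice_basis_mem: "lattice_basis n b M \<Longrightarrow> k \<in> {1..n} \<Longrightarrow> b k \<in> M"
  by (auto simp: lattice_basis_def intro: zmod.span_base)

lemma lattice_basis_subspace: "lattice_basis n b M \<Longrightarrow> zmod.subspace M"
  by (auto simp: lattice_basis_def)

text \<open>Independence is a property of the set of basis vectors; the injectivity of the enumeration
  transfers it to coefficients indexed by \<open>{1..n}\<close>.\<close>

lemma lattice_basis_unique:
  assumes "lattice_basis n b M" "(\<Sum>k=1..n. a k *s b k) = (\<Sum>k=1..n. a' k *s b k)" "k \<in> {1..n}"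
  shows "a k = a' k"
proof -
  have inj: "inj_on b {1..n}"
    using assms(1) by (simp add: lattice_basis_def)
  let ?u = "\<lambda>v. a (the_inv_into {1..n} b v) - a' (the_inv_into {1..n} b v)"
  have "(\<Sum>v\<in>b ` {1..n}. ?u v *s v) = (\<Sum>k=1..n. (a k - a' k) *s b k)"
    using inj by (simp add: sum.reindex the_inv_into_f_f)
  also have "\<dots> = 0"
    using assms(2) by (simp add: zmod.scale_left_diff_distrib sum_subtractf)
  finally have "?u (b k) = 0"
    using assms(1,3) by (intro zmod.independentD[of "b ` {1..n}" "b ` {1..n}"])
      (auto simp: lattice_basis_def)
  then show ?thesis
    using inj assms(3) by (simp add: the_inv_into_f_f)
qed

text \<open>Since \<open>\<beta>\<close> is onto a free module, its kernel is a direct summand of \<open>\<int>\<^sup>r\<close>. The coordinates with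
  respect to a basis of the kernel therefore extend to integral functionals on all of \<open>\<int>\<^sup>r\<close>. This is
  where freeness of the class group enters.\<close>

lemma dual_basis_exists:
  fixes \<beta> :: "int ^ 'r ^ 'd"
  assumes "surj (\<lambda>m. \<beta> *v m)" and basis: "lattice_basis n b (kernel_lattice \<beta>)"
  obtains c where "dual_family n b c"
proof -
  have "\<forall>l. \<exists>w. \<beta> *v w = axis l 1"
    using assms(1) by (metis surjD)
  then obtain w where w: "\<And>l. \<beta> *v w l = axis l 1"
    by metis
  \<comment> \<open>The \<open>w l\<close> define a section of \<open>\<beta>\<close>; \<open>e i\<close> is the image of the \<open>i\<close>-th unit vector under the
    projection onto \<open>ker \<beta>\<close> along that section.\<close>
  define e where "e i = axis i 1 - (\<Sum>l\<in>UNIV. \<beta> $ l $ i *s w l)" for i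
  have \<beta>_sum: "\<beta> *v (\<Sum>l\<in>UNIV. a l *s w l) = (\<chi> l. a l)" for a
  proof (rule vec_eq_iff[THEN iffD2], rule allI)
    fix l'
    have "(\<beta> *v (\<Sum>l\<in>UNIV. a l *s w l)) $ l'
        = (\<Sum>j\<in>UNIV. \<Sum>l\<in>UNIV. \<beta> $ l' $ j * (a l * w l $ j))"
      by (simp add: matrix_vector_mult_def sum_distrib_left)
    also have "\<dots> = (\<Sum>l\<in>UNIV. \<Sum>j\<in>UNIV. \<beta> $ l' $ j * (a l * w l $ j))"
      by (rule sum.swap)
    also have "\<dots> = (\<Sum>l\<in>UNIV. a l * (\<beta> *v w l) $ l')"
      unfolding matrix_vector_mult_def vec_lambda_beta sum_distrib_left
      by (intro sum.cong refl mult.left_commute)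
    finally have "(\<beta> *v (\<Sum>l\<in>UNIV. a l *s w l)) $ l' = (\<Sum>l\<in>UNIV. a l * (\<beta> *v w l) $ l')" .
    then show "(\<beta> *v (\<Sum>l\<in>UNIV. a l *s w l)) $ l' = (\<chi> l. a l) $ l'"
      by (simp add: w axis_def if_distrib cong: if_cong)
  qed
  have "e i \<in> kernel_lattice \<beta>" for i
  proof -
    have "\<beta> *v axis i 1 = (\<chi> l. \<beta> $ l $ i)"
      by (simp add: matrix_vector_mult_def axis_def if_distrib cong: if_cong)
    then show ?thesis
      by (simp add: e_def kernel_lattice_def matrix_vector_mult_diff_distrib \<beta>_sum)
  qed
  then have "\<forall>i. \<exists>a. e i = (\<Sum>k=1..n. a k *s b k)"
    using lattice_basis_coordinates[OF basis] by metis
  then obtain a where a: "\<And>i. e i = (\<Sum>k=1..n. a i k *s b k)"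
    by metis
  define c where "c k = (\<chi> i. a i k)" for k
  have expand: "m = (\<Sum>k=1..n. pairing m (c k) *s b k)" if "m \<in> kernel_lattice \<beta>" for m
  proof -
    have m: "(\<Sum>i\<in>UNIV. m $ i * \<beta> $ l $ i) = 0" for l
      using that by (simp add: kernel_lattice_def matrix_vector_mult_def vec_eq_iff mult.commute)
    have "(\<Sum>i\<in>UNIV. m $ i *s e i) = m"
    proof (rule vec_eq_iff[THEN iffD2], rule allI)
      fix j
      have "(\<Sum>i\<in>UNIV. m $ i *s e i) $ j = (\<Sum>i\<in>UNIV. m $ i * axis i 1 $ j)
          - (\<Sum>i\<in>UNIV. \<Sum>l\<in>UNIV. m $ i * (\<beta> $ l $ i * w l $ j))"
        by (simp add: e_def right_diff_distrib sum_subtractf sum_distrib_left)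
      also have "(\<Sum>i\<in>UNIV. m $ i * axis i 1 $ j) = m $ j"
        by (simp add: axis_def if_distrib cong: if_cong)
      also have "(\<Sum>i\<in>UNIV. \<Sum>l\<in>UNIV. m $ i * (\<beta> $ l $ i * w l $ j))
          = (\<Sum>l\<in>UNIV. (\<Sum>i\<in>UNIV. m $ i * \<beta> $ l $ i) * w l $ j)"
        by (subst sum.swap) (simp add: sum_distrib_right mult.assoc)
      finally show "(\<Sum>i\<in>UNIV. m $ i *s e i) $ j = m $ j"
        by (simp add: m)
    qed
    moreover have "(\<Sum>i\<in>UNIV. m $ i *s e i) = (\<Sum>k=1..n. pairing m (c k) *s b k)"
      by (simp add: a zmod.scale_sum_right pairing_def c_def zmod.scale_sum_left) (rule sum.swap)
    ultimately show ?thesis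
      by simp
  qed
  have "pairing (b j) (c k) = (if j = k then 1 else 0)" if "j \<in> {1..n}" "k \<in> {1..n}" for j k
  proof (rule lattice_basis_unique[OF basis _ that(2)])
    have "(\<Sum>k=1..n. pairing (b j) (c k) *s b k) = b j"
      using expand lattice_basis_mem[OF basis that(1)] by simp
    also have "\<dots> = (\<Sum>k=1..n. if j = k then b j else 0)"
      using that by simp
    also have "\<dots> = (\<Sum>k=1..n. (if j = k then 1 else 0) *s b k)"
      by (rule sum.cong) auto
    finally show "(\<Sum>k=1..n. pairing (b j) (c k) *s b k)
        = (\<Sum>k=1..n. (if j = k then 1 else 0) *s b k)" .
  qed
  then have "dual_family n b c"
    unfolding dual_family_def by blast
  then show ?thesis
    by (rule that)
qed

lemma pairing_add: "pairing (x + y) c = pairing x c + pairing y c"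
  by (simp add: pairing_def distrib_right sum.distrib)

lemma pairing_diff: "pairing (x - y) c = pairing x c - pairing y c"
  by (simp add: pairing_def left_diff_distrib sum_subtractf)

lemma pairing_scale: "pairing (a *s x) c = a * pairing x c"
  by (simp add: pairing_def sum_distrib_left mult.assoc)

lemma pairing_sum: "pairing (\<Sum>k\<in>A. f k) c = (\<Sum>k\<in>A. pairing (f k) c)"
  by (induction A rule: infinite_finite_induct) (simp_all add: pairing_add, simp_all add: pairing_def)

lemma pairing_combination:
  fixes n :: nat
  assumes "dual_family n b c" "k \<in> {1..n}"
  shows "pairing (\<Sum>j=1..n. a j *s b j) (c k) = a k"
proof -
  have "pairing (\<Sum>j=1..n. a j *s b j) (c k) = (\<Sum>j=1..n. a j * pairing (b j) (c k))"
    by (simp only: pairing_sum pairing_scale)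
  also have "\<dots> = (\<Sum>j=1..n. if j = k then a j else 0)"
    by (rule sum.cong) (use assms in \<open>auto simp: dual_family_def\<close>)
  finally show ?thesis
    using assms(2) by simp
qed

lemma dual_family_expansion:
  assumes M: "lattice_basis n b M" and dual: "dual_family n b c" and "m \<in> M"
  shows "m = (\<Sum>k=1..n. pairing m (c k) *s b k)"
proof -
  obtain a where a: "m = (\<Sum>k=1..n. a k *s b k)"
    using lattice_basis_coordinates[OF M assms(3)] .
  have coord: "pairing m (c k) = a k" if "k \<in> {1..n}" for k
    unfolding a using dual that by (rule pairing_combination)
  have "(\<Sum>k=1..n. a k *s b k) = (\<Sum>k=1..n. pairing m (c k) *s b k)"
    by (rule sum.cong) (simp_all only: coord)
  with a show ?thesis
    by (rule trans)
qed


section \<open>The index of a diagonal sublattice\<close>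

text \<open>In dual coordinates a sublattice spanned by multiples of the basis vectors is cut out by
  independent divisibility conditions. Both the index of \<open>L\<close> and the divisibility of \<open>q - 1\<close> by the
  invariant factors are read off from this.\<close>

lemma diagonal_sublattice_iff:
  assumes M: "lattice_basis n b M" and L: "lattice_basis n (\<lambda>k. int (d k) *s b k) L"
    and dual: "dual_family n b c"
    and "m \<in> M"
  shows "m \<in> L \<longleftrightarrow> (\<forall>k\<in>{1..n}. int (d k) dvd pairing m (c k))"
proof
  assume "m \<in> L"
  then obtain a where "m = (\<Sum>k=1..n. a k *s (int (d k) *s b k))"
    using lattice_basis_coordinates[OF L] by metis
  then have m: "m = (\<Sum>k=1..n. (a k * int (d k)) *s b k)"
    by simp
  have "pairing m (c k) = a k * int (d k)" if "k \<in> {1..n}" for k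
    unfolding m using dual that by (rule pairing_combination)
  then show "\<forall>k\<in>{1..n}. int (d k) dvd pairing m (c k)"
    by simp
next
  assume dvd: "\<forall>k\<in>{1..n}. int (d k) dvd pairing m (c k)"
  have "m = (\<Sum>k=1..n. pairing m (c k) *s b k)"
    using M dual assms(4) by (rule dual_family_expansion)
  also have "\<dots> = (\<Sum>k=1..n. (pairing m (c k) div int (d k)) *s (int (d k) *s b k))"
    by (rule sum.cong) (use dvd in simp_all)
  also have "\<dots> \<in> L"
  proof (rule zmod.subspace_sum[OF lattice_basis_subspace[OF L]])
    fix k
    assume "k \<in> {1..n}"
    then have "int (d k) *s b k \<in> L"
      by (rule lattice_basis_mem[OF L])
    with lattice_basis_subspace[OF L]
    show "(pairing m (c k) div int (d k)) *s (int (d k) *s b k) \<in> L"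
      by (rule zmod.subspace_scale)
  qed
  finally show "m \<in> L" .
qed

text \<open>Reducing the coordinates modulo the \<open>d k\<close> identifies \<open>M / L\<close> with \<open>\<Prod>k. \<int> / d k\<close>.\<close>

lemma card_diagonal_quotient:
  assumes M: "lattice_basis n b M" and L: "lattice_basis n (\<lambda>k. int (d k) *s b k) L"
    and d: "\<And>k. k \<in> {1..n} \<Longrightarrow> d k > 0"
    and dual: "dual_family n b c"
  shows "card (lattice_quotient M L) = (\<Prod>k=1..n. d k)"
proof -
  let ?E = "{(x, y). x \<in> M \<and> y \<in> M \<and> x - y \<in> L}"
  let ?R = "\<Pi>\<^sub>E k\<in>{1..n}. {0..<int (d k)}"
  \<comment> \<open>The residues of the coordinates separate the cosets of \<open>L\<close>, and every residue vector occurs.\<close>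
  define res where "res m = (\<lambda>k\<in>{1..n}. pairing m (c k) mod int (d k))" for m
  have Msub: "zmod.subspace M"
    using M by (rule lattice_basis_subspace)
  have L_iff: "x - y \<in> L \<longleftrightarrow> res x = res y" if "x \<in> M" "y \<in> M" for x y
  proof -
    have "x - y \<in> M"
      using Msub that by (rule zmod.subspace_diff)
    then have "x - y \<in> L \<longleftrightarrow> (\<forall>k\<in>{1..n}. int (d k) dvd pairing x (c k) - pairing y (c k))"
      using diagonal_sublattice_iff[OF M L dual] by (simp add: pairing_diff)
    also have "\<dots> \<longleftrightarrow> res x = res y"
      by (auto simp: res_def fun_eq_iff restrict_def mod_eq_dvd_iff)
    finally show ?thesis .
  qed
  have "res ` M = ?R"
  proof (intro equalityI subsetI)
    fix f
    assume "f \<in> res ` M"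
    then show "f \<in> ?R"
      using d by (auto simp: res_def)
  next
    fix f
    assume f: "f \<in> ?R"
    let ?m = "\<Sum>k=1..n. f k *s b k"
    have "?m \<in> M"
      using Msub lattice_basis_mem[OF M] by (intro zmod.subspace_sum zmod.subspace_scale)
    moreover have "res ?m = f"
    proof
      fix k
      show "res ?m k = f k"
      proof (cases "k \<in> {1..n}")
        case True
        then have "pairing ?m (c k) = f k"
          using dual by (intro pairing_combination)
        moreover have "f k \<in> {0..<int (d k)}"
          using f True by auto
        ultimately show ?thesis
          using True by (simp add: res_def)
      next
        case False
        then show ?thesis
          using f by (auto simp: res_def PiE_def extensional_def)
      qed
    qed
    ultimately show "f \<in> res ` M"
      by (metis imageI)
  qed
  moreover have "lattice_quotient M L = (\<lambda>f. {x \<in> M. res x = f}) ` (res ` M)"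
  proof -
    have "?E `` {x} = {y \<in> M. res y = res x}" if "x \<in> M" for x
      using that L_iff by (auto simp: Image_def)
    then show ?thesis
      by (simp add: lattice_quotient_def quotient_def UNION_singleton_eq_range image_image
          cong: image_cong_simp)
  qed
  moreover have "inj_on (\<lambda>f. {x \<in> M. res x = f}) (res ` M)"
    by (auto simp: inj_on_def)
  ultimately have "card (lattice_quotient M L) = card ?R"
    by (simp add: card_image)
  then show ?thesis
    by (simp add: card_PiE)
qed


section \<open>Strongly convex cones\<close>

lemma convex_cone_sum:
  assumes "convex_cone S" "finite A" "\<And>x. x \<in> A \<Longrightarrow> f x \<in> S"
  shows "sum f A \<in> S"
  using assms(2,3)
  by induction (auto intro: convex_cone_contains_0 convex_cone_add assms(1))

text \<open>A nontrivial relation with nonnegative coefficients would place a line inside the cone.\<close>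

lemma convex_hull_avoids_0:
  assumes cone: "convex_cone \<sigma>" and "strongly_convex \<sigma>"
    and "finite S" "S \<subseteq> \<sigma>" "0 \<notin> S"
  shows "0 \<notin> convex hull S"
proof
  assume "0 \<in> convex hull S"
  then obtain u where u: "\<forall>x\<in>S. 0 \<le> u x" "sum u S = 1" "(\<Sum>x\<in>S. u x *\<^sub>R x) = 0"
    using assms(3) by (auto simp: convex_hull_finite)
  have "\<exists>x\<in>S. u x \<noteq> 0"
    using u(2) sum.neutral[of S u] by fastforce
  then obtain x where x: "x \<in> S" "u x \<noteq> 0"
    by blast
  \<comment> \<open>Moving one nonzero term of a relation to the other side puts it and its negative in \<open>\<sigma>\<close>.\<close>
  have "u x *\<^sub>R x \<in> \<sigma>"
    using cone u(1) x assms(4) by (auto intro: convex_cone_scaleR)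
  moreover have "- (u x *\<^sub>R x) = (\<Sum>y\<in>S - {x}. u y *\<^sub>R y)"
    using u(3) sum.remove[OF assms(3) x(1), of "\<lambda>x. u x *\<^sub>R x"] by (simp add: eq_neg_iff_add_eq_0 neg_eq_iff_add_eq_0)
  moreover have "(\<Sum>y\<in>S - {x}. u y *\<^sub>R y) \<in> \<sigma>"
    using cone u(1) assms(3,4) by (intro convex_cone_sum) (auto intro: convex_cone_scaleR)
  ultimately have "u x *\<^sub>R x \<in> \<sigma>" "- (u x *\<^sub>R x) \<in> \<sigma>"
    by simp_all
  then have "- (u x *\<^sub>R x) \<in> \<sigma> \<inter> uminus ` \<sigma>"
    by blast
  then have "- (u x *\<^sub>R x) \<in> {0}"
    using assms(2) by (simp only: strongly_convex_def)
  then show False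
    using x assms(5) by auto
qed

text \<open>The convex hull of the \<open>v i\<close> avoids the origin, so a real functional is bounded below on it by
  a positive number. A large multiple of that functional stays positive after rounding.\<close>

lemma strongly_convex_integer_functional:
  fixes v :: "'i \<Rightarrow> int ^ 'n"
  assumes cone: "convex_cone \<sigma>" and "strongly_convex \<sigma>" and "finite I"
    and v: "\<And>i. i \<in> I \<Longrightarrow> real_vec (v i) \<in> \<sigma>" "\<And>i. i \<in> I \<Longrightarrow> v i \<noteq> 0"
  obtains u :: "int ^ 'n" where "\<And>i. i \<in> I \<Longrightarrow> pairing (v i) u > 0"
proof -
  let ?S = "convex hull ((\<lambda>i. real_vec (v i)) ` I)"
  have "0 \<notin> (\<lambda>i. real_vec (v i)) ` I"
  proof
    assume "0 \<in> (\<lambda>i. real_vec (v i)) ` I"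
    then obtain i where i: "i \<in> I" "real_vec (v i) = 0"
      by auto
    then have "v i = 0"
      by (simp add: real_vec_def vec_eq_iff)
    with v(2) i(1) show False
      by blast
  qed
  then have "0 \<notin> ?S"
    using assms(3) v(1) by (intro convex_hull_avoids_0[OF cone assms(2)]) auto
  moreover have "closed ?S"
    using assms(3) by (intro compact_imp_closed finite_imp_compact_convex_hull) simp
  ultimately obtain a r where a: "r > 0" "\<And>x. x \<in> ?S \<Longrightarrow> inner a x > r"
    using separating_hyperplane_closed_0[of ?S] by (auto simp: convex_convex_hull)
  \<comment> \<open>Rounding \<open>N a\<close> changes its product with any \<open>v i\<close> by at most the 1-norm of \<open>v i\<close>,
    and \<open>C\<close> bounds all these norms.\<close>
  define C where "C = (\<Sum>i\<in>I. \<Sum>j\<in>UNIV. \<bar>real_of_int (v i $ j)\<bar>)"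
  define N where "N = (C + 1) / r"
  have "C \<ge> 0"
    by (simp add: C_def sum_nonneg)
  then have N: "N > 0" "N * r = C + 1"
    using a(1) by (simp_all add: N_def)
  define u :: "int ^ 'n" where "u = (\<chi> j. \<lfloor>N * a $ j\<rfloor>)"
  have "pairing (v i) u > 0" if i: "i \<in> I" for i
  proof -
    have "r < inner a (real_vec (v i))"
      using i by (intro a(2) hull_inc) auto
    also have "\<dots> = (\<Sum>j\<in>UNIV. of_int (v i $ j) * a $ j)"
      by (simp add: inner_vec_def real_vec_def mult.commute)
    finally have "N * r < N * (\<Sum>j\<in>UNIV. of_int (v i $ j) * a $ j)"
      using N(1) by simp
    also have "\<dots> = (\<Sum>j\<in>UNIV. of_int (v i $ j) * (N * a $ j))"
      by (simp add: sum_distrib_left mult.left_commute)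
    also have "\<dots> \<le> (\<Sum>j\<in>UNIV. of_int (v i $ j * u $ j) + \<bar>of_int (v i $ j)\<bar>)"
    proof (rule sum_mono)
      fix j
      have "of_int (v i $ j) * (N * a $ j - of_int (u $ j)) \<le> \<bar>of_int (v i $ j) * (N * a $ j - of_int (u $ j))\<bar>"
        by simp
      also have "\<dots> \<le> \<bar>of_int (v i $ j)\<bar> * 1"
        unfolding abs_mult
      proof (rule mult_left_mono)
        show "\<bar>N * a $ j - of_int (u $ j)\<bar> \<le> 1"
          unfolding u_def vec_lambda_beta by linarith
      qed simp
      finally show "of_int (v i $ j) * (N * a $ j) \<le> of_int (v i $ j * u $ j) + \<bar>of_int (v i $ j)\<bar>"
        by (simp add: right_diff_distrib)
    qed
    also have "\<dots> = of_int (pairing (v i) u) + (\<Sum>j\<in>UNIV. \<bar>of_int (v i $ j)\<bar>)"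
      by (simp add: pairing_def sum.distrib)
    also have "(\<Sum>j\<in>UNIV. \<bar>real_of_int (v i $ j)\<bar>) \<le> C"
      unfolding C_def
      by (rule member_le_sum[OF i, of "\<lambda>i. \<Sum>j\<in>UNIV. \<bar>real_of_int (v i $ j)\<bar>"])
        (auto intro: sum_nonneg assms(3))
    finally show ?thesis
      using N(2) by simp
  qed
  then show ?thesis
    by (rule that)
qed


section \<open>Points of the zero locus lie in the torus\<close>

text \<open>Outside the irrelevant locus the vanishing coordinates of \<open>P\<close> belong to rays of one cone. An
  integral functional that is positive on these rays gives an element of the lattice whose binomial
  takes a nonzero value at \<open>P\<close> as soon as some coordinate vanishes. It is enough for the lattice to
  contain a positive multiple of \<open>im \<phi>\<close>, because multiples keep the signs.\<close>

lemma lattice_ideal_vanishing_imp_torus: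
  fixes P :: "'k::field alg_closure ^ 'r::finite" and \<phi> :: "int ^ 'n ^ 'r"
  assumes "fan \<Sigma>" and gen: "ray_generators \<Sigma> \<phi>"
    and P: "P \<notin> zero_locus (irrelevant_ideal \<Sigma> \<phi> :: ('k, 'r) cox_ring set)"
    and N: "N > 0" and L: "\<And>u. int N *s (\<phi> *v u) \<in> L"
    and vanish: "\<And>m. m \<in> L \<Longrightarrow>
      eval_at (monomial (pos_part m) - monomial (pos_part (- m)) :: ('k, 'r) cox_ring) P = 0"
  shows "P \<in> torus"
proof (rule ccontr)
  assume "P \<notin> torus"
  then obtain i\<^sub>0 where i\<^sub>0: "P $ i\<^sub>0 = 0"
    by (auto simp: torus_def)
  let ?G = "\<lambda>\<sigma>. \<Prod>i\<in>{i. \<not> ray (\<phi> $ i) \<subseteq> \<sigma>}. variable i :: ('k, 'r) cox_ring"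
  have "\<exists>\<sigma>\<in>\<Sigma>. eval_at (?G \<sigma>) P \<noteq> 0"
  proof (rule ccontr)
    assume "\<not> (\<exists>\<sigma>\<in>\<Sigma>. eval_at (?G \<sigma>) P \<noteq> 0)"
    then have "eval_at F P = 0" if "F \<in> {?G \<sigma> |\<sigma>. \<sigma> \<in> \<Sigma>}" for F
      using that by blast
    then have "eval_at F P = 0" if "F \<in> irrelevant_ideal \<Sigma> \<phi>" for F :: "('k, 'r) cox_ring"
      using that unfolding irrelevant_ideal_def by (rule eval_at_span_eq_0)
    with P show False
      by (simp add: zero_locus_def)
  qed
  then obtain \<sigma> where \<sigma>: "\<sigma> \<in> \<Sigma>" and "eval_at (?G \<sigma>) P \<noteq> 0"
    by blast
  then have nz: "P $ i \<noteq> 0" if "\<not> ray (\<phi> $ i) \<subseteq> \<sigma>" for i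
    using that by (auto simp: eval_at_prod_variables)
  \<comment> \<open>All rays along which a coordinate of \<open>P\<close> vanishes therefore lie in the cone \<open>\<sigma>\<close>.\<close>
  have cone: "convex_cone \<sigma>" and sc: "strongly_convex \<sigma>"
    using assms(1) \<sigma> by (auto simp: fan_def rational_polyhedral_cone_def convex_cone_convex_cone_hull)
  have in_\<sigma>: "real_vec (\<phi> $ i) \<in> \<sigma>" if "P $ i = 0" for i
  proof -
    have "real_vec (\<phi> $ i) \<in> ray (\<phi> $ i)"
      unfolding ray_def by (rule hull_inc) simp
    then show ?thesis
      using nz that by blast
  qed
  have nonzero: "\<phi> $ i \<noteq> 0" for i
    using gen by (auto simp: ray_generators_def primitive_def dest!: spec[of _ i])
  obtain u where u: "\<And>i. i \<in> {i. P $ i = 0} \<Longrightarrow> pairing (\<phi> $ i) u > 0"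
    by (rule strongly_convex_integer_functional[OF cone sc, of "{i. P $ i = 0}" "\<lambda>i. \<phi> $ i"])
      (auto simp: in_\<sigma> nonzero)
  \<comment> \<open>\<open>m\<close> is positive wherever \<open>P\<close> vanishes, so \<open>P\<close> kills the monomial of its positive part, while
    the negative part only involves nonzero coordinates.\<close>
  define m where "m = int N *s (\<phi> *v u)"
  have m: "m $ i > 0" if "P $ i = 0" for i
    using u that N by (simp add: m_def matrix_vector_mult_def pairing_def)
  have "eval_at (monomial (pos_part m) - monomial (pos_part (- m)) :: ('k, 'r) cox_ring) P = 0"
    using L by (intro vanish) (simp add: m_def)
  moreover have "eval_at (monomial (pos_part m) :: ('k, 'r) cox_ring) P = 0"
    using i\<^sub>0 m[OF i\<^sub>0] by (auto simp: eval_at_monomial pos_part.rep_eq)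
  moreover have "eval_at (monomial (pos_part (- m)) :: ('k, 'r) cox_ring) P \<noteq> 0"
    using m by (fastforce simp: eval_at_monomial pos_part.rep_eq)
  ultimately show False
    by (simp add: eval_at_diff)
qed

lemma torus_not_irrelevant:
  fixes P :: "'k::field alg_closure ^ 'r::finite"
  assumes "complete_fan \<Sigma>" "P \<in> torus"
  shows "P \<notin> zero_locus (irrelevant_ideal \<Sigma> \<phi> :: ('k, 'r) cox_ring set)"
proof -
  obtain \<sigma> where \<sigma>: "\<sigma> \<in> \<Sigma>"
    using assms(1) by (auto simp: complete_fan_def)
  let ?F = "\<Prod>i\<in>{i. \<not> ray (\<phi> $ i) \<subseteq> \<sigma>}. variable i :: ('k, 'r) cox_ring"
  have "?F \<in> irrelevant_ideal \<Sigma> \<phi>"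
    unfolding irrelevant_ideal_def using \<sigma> by (intro ideal.span_base) blast
  moreover have "eval_at ?F P \<noteq> 0"
    using assms(2) by (simp add: eval_at_prod_variables torus_def)
  ultimately show ?thesis
    by (auto simp: zero_locus_def)
qed


section \<open>Orbits in the torus\<close>

lemma cox_group_iff:
  "g \<in> cox_group \<beta> \<longleftrightarrow> g \<in> torus \<and> (\<forall>m\<in>kernel_lattice \<beta>. laurent m g = 1)"
  by (simp add: cox_group_def torus_def laurent_def)

lemma mem_cox_orbit_self: "P \<in> cox_orbit \<beta> P"
proof -
  have "(\<chi> i. 1) \<in> cox_group \<beta>"
    by (simp add: cox_group_def)
  moreover have "P = (\<chi> i. (\<chi> i. 1) $ i * P $ i)"
    by (simp add: vec_eq_iff)
  ultimately show ?thesis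
    unfolding cox_orbit_def by blast
qed

text \<open>By definition the group consists of the torus elements on which all characters from \<open>ker \<beta>\<close> are
  trivial, so these characters separate its orbits in the torus.\<close>

lemma mem_cox_orbit_iff:
  assumes P: "P \<in> torus"
  shows "Q \<in> cox_orbit \<beta> P \<longleftrightarrow>
    Q \<in> torus \<and> (\<forall>m\<in>kernel_lattice \<beta>. laurent m Q = laurent m P)"
proof
  assume "Q \<in> cox_orbit \<beta> P"
  then obtain g where "g \<in> cox_group \<beta>" "Q = (\<chi> i. g $ i * P $ i)"
    by (auto simp: cox_orbit_def)
  with P show "Q \<in> torus \<and> (\<forall>m\<in>kernel_lattice \<beta>. laurent m Q = laurent m P)"
    by (auto simp: cox_group_iff laurent_mult) (simp add: torus_def)
next
  assume Q: "Q \<in> torus \<and> (\<forall>m\<in>kernel_lattice \<beta>. laurent m Q = laurent m P)"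
  let ?g = "\<chi> i. Q $ i / P $ i"
  have "?g \<in> cox_group \<beta>"
    using P Q laurent_nonzero[OF P] by (auto simp: cox_group_iff laurent_divide) (simp add: torus_def)
  moreover have "Q = (\<chi> i. ?g $ i * P $ i)"
    using P by (simp add: vec_eq_iff torus_def)
  ultimately show "Q \<in> cox_orbit \<beta> P"
    unfolding cox_orbit_def by blast
qed

lemma cox_orbit_eq_iff:
  assumes "P \<in> torus" "Q \<in> torus"
  shows "cox_orbit \<beta> P = cox_orbit \<beta> Q \<longleftrightarrow> (\<forall>m\<in>kernel_lattice \<beta>. laurent m P = laurent m Q)"
  using mem_cox_orbit_self[of P \<beta>] assms
  by (auto simp: mem_cox_orbit_iff set_eq_iff)

text \<open>The two exponents differ by \<open>m\<close>, which has degree zero.\<close>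

lemma homogeneous_binomial:
  assumes "m \<in> kernel_lattice \<beta>"
  shows "homogeneous \<beta> (monomial (pos_part m) - monomial (pos_part (- m)) :: ('k::field, 'r::finite) cox_ring)"
proof -
  let ?f = "\<lambda>m. \<chi> j. int (Poly_Mapping.lookup (pos_part m) j)"
  have "m = ?f m - ?f (- m)"
    by (simp add: vec_eq_iff pos_part.rep_eq)
  then have "\<beta> *v ?f m - \<beta> *v ?f (- m) = \<beta> *v m"
    by (metis matrix_vector_mult_diff_distrib)
  also have "\<dots> = 0"
    using assms by (simp add: kernel_lattice_def)
  finally have "multidegree \<beta> (pos_part (- m)) = multidegree \<beta> (pos_part m)"
    by (simp add: multidegree_def)
  moreover have "a = pos_part m \<or> a = pos_part (- m)"
    if "a \<in> Poly_Mapping.keys (monomial (pos_part m) - monomial (pos_part (- m)) :: ('k, 'r) cox_ring)" for a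
    using that by (auto simp: in_keys_iff lookup_minus monomial_def lookup_single when_def split: if_splits)
  ultimately show ?thesis
    unfolding homogeneous_def by metis
qed

text \<open>On a whole orbit the characters from \<open>L\<close> are constant, so the binomials vanish at one point of the
  orbit iff they vanish at all of them.\<close>

lemma toric_zero_locus_lattice_ideal:
  fixes L :: "(int ^ 'r) set" and \<phi> :: "int ^ 'n ^ 'r"
  assumes "complete_fan \<Sigma>" "ray_generators \<Sigma> \<phi>" "N > 0"
    and L: "L \<subseteq> kernel_lattice \<beta>" "\<And>u. int N *s (\<phi> *v u) \<in> L"
  shows "toric_zero_locus \<Sigma> \<phi> \<beta> (lattice_ideal L :: ('k::field, 'r) cox_ring set)
    = cox_orbit \<beta> ` {P \<in> rational_vectors \<inter> torus. \<forall>m\<in>L. laurent m P = 1}"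
proof (intro equalityI subsetI)
  let ?bin = "\<lambda>m. monomial (pos_part m) - monomial (pos_part (- m)) :: ('k, 'r) cox_ring"
  have bin: "?bin m \<in> lattice_ideal L" if "m \<in> L" for m
    using that unfolding lattice_ideal_def by (intro ideal.span_base) blast
  fix p :: "('k alg_closure ^ 'r) set"
  {
    assume "p \<in> toric_zero_locus \<Sigma> \<phi> \<beta> (lattice_ideal L :: ('k, 'r) cox_ring set)"
    then obtain P where P: "p = cox_orbit \<beta> P" "P \<in> rational_vectors"
        "P \<notin> zero_locus (irrelevant_ideal \<Sigma> \<phi> :: ('k, 'r) cox_ring set)"
      and van: "\<forall>Q\<in>p. \<forall>F\<in>lattice_ideal L :: ('k, 'r) cox_ring set. homogeneous \<beta> F \<longrightarrow> eval_at F Q = 0"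
      unfolding toric_zero_locus_def toric_points_def by blast
    have P0: "eval_at (?bin m) P = 0" if "m \<in> L" for m
    proof -
      have "homogeneous \<beta> (?bin m)"
        using that L(1) by (intro homogeneous_binomial) blast
      then show ?thesis
        using van bin[OF that] P(1) mem_cox_orbit_self[of P \<beta>] by blast
    qed
    have "fan \<Sigma>"
      using assms(1) by (simp add: complete_fan_def)
    then have torus: "P \<in> torus"
      using assms(2) P(3) assms(3) L(2) P0 by (rule lattice_ideal_vanishing_imp_torus)
    moreover have "laurent m P = 1" if "m \<in> L" for m
      using P0[OF that] by (simp only: eval_at_binomial_eq_0_iff[OF torus])
    ultimately show "p \<in> cox_orbit \<beta> ` {P \<in> rational_vectors \<inter> torus. \<forall>m\<in>L. laurent m P = 1}"
      using P(1,2) by blast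
  next
    assume "p \<in> cox_orbit \<beta> ` {P \<in> rational_vectors \<inter> torus. \<forall>m\<in>L. laurent m P = 1}"
    then obtain P where P: "p = cox_orbit \<beta> P" "P \<in> rational_vectors" "P \<in> torus"
      "\<And>m. m \<in> L \<Longrightarrow> laurent m P = 1"
      by blast
    have "p \<in> toric_points \<Sigma> \<phi> \<beta>"
      using P(1,2) torus_not_irrelevant[OF assms(1) P(3)] unfolding toric_points_def by blast
    moreover have "eval_at F Q = 0" if Q: "Q \<in> p" and F: "F \<in> lattice_ideal L" for Q and F :: "('k, 'r) cox_ring"
    proof (rule eval_at_span_eq_0[OF _ F[unfolded lattice_ideal_def]])
      fix G :: "('k, 'r) cox_ring"
      assume "G \<in> {monomial (pos_part m) - monomial (pos_part (- m)) |m. m \<in> L}"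
      then obtain m where m: "G = ?bin m" "m \<in> L"
        by blast
      have Q': "Q \<in> torus" "laurent m Q = laurent m P"
        using Q m(2) L(1) mem_cox_orbit_iff[OF P(3)] by (auto simp: P(1))
      then show "eval_at G Q = 0"
        using P(4)[OF m(2)] by (simp only: m(1) eval_at_binomial_eq_0_iff)
    qed
    ultimately show "p \<in> toric_zero_locus \<Sigma> \<phi> \<beta> (lattice_ideal L :: ('k, 'r) cox_ring set)"
      unfolding toric_zero_locus_def by blast
  }
qed


section \<open>Counting the rational points\<close>

text \<open>An orbit in the torus is determined by the values \<open>t k\<close> of the characters \<open>b k\<close>, and the
  conditions from \<open>L\<close> say that \<open>t k ^ d k = 1\<close>. Conversely, multiplying powers of the \<open>t k\<close> along a
  dual family yields a rational point with the values \<open>t k\<close>, so every such tuple occurs.\<close>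

lemma card_rational_torus_orbits:
  fixes \<beta> :: "int ^ 'r ^ 'd" and L :: "(int ^ 'r) set"
  assumes M: "lattice_basis n b (kernel_lattice \<beta>)" and L: "lattice_basis n (\<lambda>k. int (d k) *s b k) L"
    and d: "\<And>k. k \<in> {1..n} \<Longrightarrow> d k dvd CARD('k) - 1"
    and dual: "dual_family n b c"
  shows "card (cox_orbit \<beta> ` {P :: 'k::{field,finite} alg_closure ^ 'r.
      P \<in> rational_vectors \<inter> torus \<and> (\<forall>m\<in>L. laurent m P = 1)}) = (\<Prod>k=1..n. d k)"
    (is "card (_ ` ?Pts) = _")
proof -
  let ?T = "\<Pi>\<^sub>E k\<in>{1..n}. {t :: 'k. t ^ d k = 1}"
  \<comment> \<open>\<open>pt t\<close> is the rational torus point whose character takes \<open>b k\<close> to \<open>t k\<close>.\<close>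
  define p where "p t = (\<chi> i. \<Prod>k=1..n. t k powi (c k $ i))" for t :: "nat \<Rightarrow> 'k"
  define pt where "pt t = (\<chi> i. to_ac (p t $ i))" for t
  have dpos: "d k > 0" if "k \<in> {1..n}" for k
    using d[OF that] card_field_ge_2[where 'k = 'k] by (auto intro!: Nat.gr0I)
  have t0: "t k \<noteq> 0" if "t \<in> ?T" "k \<in> {1..n}" for t k
  proof
    assume "t k = 0"
    moreover have "t k ^ d k = 1"
      using that by auto
    ultimately show False
      using dpos[OF that(2)] by (simp add: zero_power)
  qed
  have torus: "pt t \<in> torus" if "t \<in> ?T" for t
    using t0[OF that] by (simp add: pt_def p_def torus_def power_int_not_zero)
  have coord: "laurent (b j) (pt t) = to_ac (t j)" if t: "t \<in> ?T" and j: "j \<in> {1..n}" for t j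
  proof -
    have "laurent (b j) (p t) = (\<Prod>k=1..n. t k powi pairing (b j) (c k))"
      unfolding p_def using t0[OF t] by (intro laurent_monomial_vector)
    also have "\<dots> = (\<Prod>k=1..n. if j = k then t k else 1)"
      by (rule prod.cong) (use dual j in \<open>auto simp: dual_family_def\<close>)
    finally show ?thesis
      using j by (simp add: pt_def laurent_to_ac)
  qed
  have eq_iff: "cox_orbit \<beta> P = cox_orbit \<beta> Q \<longleftrightarrow> (\<forall>k\<in>{1..n}. laurent (b k) P = laurent (b k) Q)"
    if "P \<in> torus" "Q \<in> torus" for P Q :: "'k alg_closure ^ 'r"
  proof -
    have "laurent m P = laurent m Q"
      if m: "m \<in> kernel_lattice \<beta>" and k: "\<forall>k\<in>{1..n}. laurent (b k) P = laurent (b k) Q" for m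
    proof -
      obtain a where "m = (\<Sum>k=1..n. a k *s b k)"
        using lattice_basis_coordinates[OF M m] .
      then show ?thesis
        using k \<open>P \<in> torus\<close> \<open>Q \<in> torus\<close> by (simp add: laurent_sum)
    qed
    then show ?thesis
      unfolding cox_orbit_eq_iff[OF that] using lattice_basis_mem[OF M] by blast
  qed
  have inj: "inj_on (\<lambda>t. cox_orbit \<beta> (pt t)) ?T"
  proof (rule inj_onI)
    fix s t
    assume st: "s \<in> ?T" "t \<in> ?T" "cox_orbit \<beta> (pt s) = cox_orbit \<beta> (pt t)"
    then have "\<forall>k\<in>{1..n}. laurent (b k) (pt s) = laurent (b k) (pt t)"
      using eq_iff torus by blast
    then have "\<forall>k\<in>{1..n}. s k = t k"
      using st by (simp add: coord)
    then show "s = t"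
      using st(1,2) by (intro PiE_ext) auto
  qed
  have "(\<lambda>t. cox_orbit \<beta> (pt t)) ` ?T = cox_orbit \<beta> ` ?Pts"
  proof (intro equalityI subsetI)
    fix x
    assume "x \<in> (\<lambda>t. cox_orbit \<beta> (pt t)) ` ?T"
    then obtain t where t: "t \<in> ?T" "x = cox_orbit \<beta> (pt t)"
      by blast
    have "laurent m (pt t) = 1" if m: "m \<in> L" for m
    proof -
      obtain a where "m = (\<Sum>k=1..n. a k *s (int (d k) *s b k))"
        using lattice_basis_coordinates[OF L m] .
      then have "laurent m (pt t) = (\<Prod>k=1..n. laurent (int (d k) *s b k) (pt t) powi a k)"
        using torus[OF t(1)] by (simp only: laurent_sum)
      also have "\<dots> = 1"
      proof (rule prod.neutral, rule ballI)
        fix k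
        assume k: "k \<in> {1..n}"
        then have "t k ^ d k = 1"
          using t(1) by auto
        then have "laurent (int (d k) *s b k) (pt t) = 1"
          by (simp add: laurent_scale coord[OF t(1) k] flip: to_ac_power)
        then show "laurent (int (d k) *s b k) (pt t) powi a k = 1"
          by simp
      qed
      finally show ?thesis .
    qed
    moreover have "pt t \<in> rational_vectors"
      by (auto simp: rational_vectors_def pt_def)
    ultimately show "x \<in> cox_orbit \<beta> ` ?Pts"
      using t torus by blast
  next
    fix x
    assume "x \<in> cox_orbit \<beta> ` ?Pts"
    then obtain P where P: "x = cox_orbit \<beta> P" "P \<in> rational_vectors" "P \<in> torus"
      "\<And>m. m \<in> L \<Longrightarrow> laurent m P = 1"
      by blast
    from P(2) obtain r where "\<And>i. P $ i = to_ac (r i)"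
      unfolding rational_vectors_def by (auto dest: choice)
    then have r: "P = (\<chi> i. to_ac ((\<chi> i. r i) $ i))"
      by (simp add: vec_eq_iff)
    define t where "t = (\<lambda>k\<in>{1..n}. laurent (b k) (\<chi> i. r i))"
    have Pt: "laurent (b k) P = to_ac (t k)" if "k \<in> {1..n}" for k
      using that unfolding r laurent_to_ac t_def by simp
    have t: "t \<in> ?T"
    proof (rule PiE_I)
      fix k
      assume k: "k \<in> {1..n}"
      have "laurent (int (d k) *s b k) P = 1"
        using lattice_basis_mem[OF L k] by (rule P(4))
      then have "to_ac (t k ^ d k) = to_ac 1"
        by (simp add: laurent_scale Pt[OF k])
      then show "t k \<in> {t. t ^ d k = 1}"
        by (simp only: to_ac_eq_iff mem_Collect_eq)
    qed (auto simp: t_def)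
    have "x = cox_orbit \<beta> (pt t)"
      unfolding P(1) using eq_iff[OF P(3) torus[OF t]] Pt coord[OF t] by simp
    with t show "x \<in> (\<lambda>t. cox_orbit \<beta> (pt t)) ` ?T"
      by blast
  qed
  then have "card (cox_orbit \<beta> ` ?Pts) = card ?T"
    using card_image[OF inj] by simp
  also have "\<dots> = (\<Prod>k=1..n. d k)"
    unfolding card_PiE[OF finite_atLeastAtMost]
    by (rule prod.cong) (simp_all only: card_roots_of_unity d)
  finally show ?thesis .
qed

theorem theorem4p4:
  fixes \<Sigma> :: "(real ^ 'n) set set"
    and \<phi> :: "int ^ 'n ^ 'r"
    and \<beta> :: "int ^ 'r ^ 'd"
    and L :: "(int ^ 'r) set"
    and d :: "nat \<Rightarrow> nat"
  assumes "simplicial_fan \<Sigma>" and "complete_fan \<Sigma>"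
    and "ray_generators \<Sigma> \<phi>"
    and "short_exact \<phi> \<beta>"
    and "zmod.subspace L"
    and "(\<lambda>m. int (CARD('k) - 1) *s m) ` kernel_lattice \<beta> \<subseteq> L"
    and "L \<subseteq> kernel_lattice \<beta>"
    and "invariant_factors CARD('n) (kernel_lattice \<beta>) L d"
  shows "card (toric_zero_locus \<Sigma> \<phi> \<beta>
            (lattice_ideal L :: ('k::{field,finite}, 'r) cox_ring set))
          = card (lattice_quotient (kernel_lattice \<beta>) L)
       \<and> card (lattice_quotient (kernel_lattice \<beta>) L) = (\<Prod>i=1..CARD('n). d i)"
proof -
  let ?n = "CARD('n)" and ?M = "kernel_lattice \<beta>"
  obtain b where M: "lattice_basis ?n b ?M" and Lb: "lattice_basis ?n (\<lambda>k. int (d k) *s b k) L"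
    and dpos: "\<And>k. k \<in> {1..?n} \<Longrightarrow> d k > 0"
    using assms(8) unfolding invariant_factors_def by blast
  have surj: "surj (\<lambda>m. \<beta> *v m)" and \<phi>: "\<And>u. \<phi> *v u \<in> ?M"
    using assms(4) unfolding short_exact_def by blast+
  obtain c where dual: "dual_family ?n b c"
    using dual_basis_exists[OF surj M] .
  \<comment> \<open>The \<open>k\<close>-th coordinate of \<open>(q - 1) b k\<close>, an element of \<open>L\<close>, is \<open>q - 1\<close>.\<close>
  have d_dvd: "d k dvd CARD('k) - 1" if k: "k \<in> {1..?n}" for k
  proof -
    let ?m = "int (CARD('k) - 1) *s b k"
    have bk: "b k \<in> ?M"
      using M k by (rule lattice_basis_mem)
    then have "?m \<in> L" "?m \<in> ?M"
      using assms(6,7) by blast+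
    then have "int (d k) dvd pairing ?m (c k)"
      using diagonal_sublattice_iff[OF M Lb dual] k by blast
    also have "pairing ?m (c k) = int (CARD('k) - 1)"
      using dual k by (simp only: pairing_scale dual_family_def) simp
    finally show ?thesis
      by (simp only: of_nat_dvd_iff)
  qed
  have "toric_zero_locus \<Sigma> \<phi> \<beta> (lattice_ideal L :: ('k, 'r) cox_ring set)
    = cox_orbit \<beta> ` {P \<in> rational_vectors \<inter> torus. \<forall>m\<in>L. laurent m P = 1}"
    using assms(2,3) _ assms(7)
  proof (rule toric_zero_locus_lattice_ideal)
    show "CARD('k) - 1 > 0"
      using card_field_ge_2[where 'k = 'k] by simp
    show "int (CARD('k) - 1) *s (\<phi> *v u) \<in> L" for u
      using assms(6) \<phi> by blast
  qed
  also have "card \<dots> = (\<Prod>k=1..?n. d k)"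
    using M Lb d_dvd dual by (rule card_rational_torus_orbits)
  finally show ?thesis
    using card_diagonal_quotient[OF M Lb dpos dual] by simp
qed

end
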